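(* Let $d\ge 1$ and $k\ge 0$ be integers and let $\lambda$ be a linear functional on $\Pi=\Pi(\mathbb{R}^d)$. Then $\lambda\perp\Pi_{\le k}$ if and only if $$(\lambda\otimes\lambda)\|x-y\|^{2r}=0\quad\text{for all integers } r \text{ with } 0\le r\le k.$$
   Context: $\Pi=\Pi(\mathbb{R}^d)$ is the real vector space of all polynomials with real coefficients in $d$ real variables. $\Pi_{\le k}$ is the subspace of polynomials of total degree $\le k$. For a linear functional $\lambda$ on $\Pi$ (any element of the algebraic dual $\Pi'$) and a subspace $V\subseteq\Pi$, $\lambda\perp V$ means that $\lambda$ vanishes on $V$. $\|\cdot\|$ is the Euclidean norm on $\mathbb{R}^d$. For linear functionals $\lambda,\mu$ on $\Pi$, $\lambda\otimes\mu:\Pi\otimes\Pi\to\mathbb{R}$ is the linear map determined by $x^\alpha\otimes y^\beta\mapsto \lambda(()^\alpha)\,\mu(()^\beta)$ for all multi-indices $\alpha,\beta\in\mathbb{Z}_+^d$, where $()^\alpha$ denotes the monomial $x\mapsto x(1)^{\alpha(1)}\cdots x(d)^{\alpha(d)}$ and $\Pi\otimes\Pi$ is identified with the polynomials in $(x,y)\in\mathbb{R}^d\times\mathbb{R}^d$. Thus $(\lambda\otimes\mu)\|x-y\|^{2r}$ is the number obtained from the polynomial $(x,y)\mapsto\|x-y\|^{2r}$ by applying $\lambda$ to it as a polynomial in $x$ and $\mu$ to it as a polynomial in $y$. *)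

theory Defs
  imports "HOL-Analysis.Analysis" "HOL-Analysis.Finite_Function_Topology"
begin

text \<open>
  Multi-indices are finitely supported exponent functions on the finite index type \<open>'n\<close> (so
  \<open>d = CARD('n)\<close>), and a polynomial is the finitely supported family of its coefficients;
  the library provides the ring structure (convolution) and the real vector space structure.
  A polynomial in \<open>(x, y)\<close>, i.e. an element of the tensor square of \<open>'n rpoly\<close>, is indexed by
  pairs of multi-indices, the pair \<open>(\<alpha>, \<beta>)\<close> standing for \<open>x\<^sup>\<alpha> y\<^sup>\<beta>\<close>.
\<close>

type_synonym 'n multi_index = "'n \<Rightarrow>\<^sub>0 nat"
type_synonym 'n rpoly = "'n multi_index \<Rightarrow>\<^sub>0 real"
type_synonym 'n rpoly2 = "('n multi_index \<times> 'n multi_index) \<Rightarrow>\<^sub>0 real"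

definition monomial :: "'n::finite multi_index \<Rightarrow> 'n rpoly" where
  "monomial \<alpha> = Poly_Mapping.single \<alpha> 1"

definition monomial2 :: "'n::finite multi_index \<Rightarrow> 'n multi_index \<Rightarrow> 'n rpoly2" where
  "monomial2 \<alpha> \<beta> = Poly_Mapping.single (\<alpha>, \<beta>) 1"

definition multi_degree :: "'n::finite multi_index \<Rightarrow> nat" where
  "multi_degree \<alpha> = (\<Sum>i\<in>UNIV. Poly_Mapping.lookup \<alpha> i)"

definition polys_le :: "nat \<Rightarrow> ('n::finite) rpoly set" where
  "polys_le k = {p. \<forall>\<alpha>\<in>Poly_Mapping.keys p. multi_degree \<alpha> \<le> k}"

definition annihilates :: "('n::finite rpoly \<Rightarrow> real) \<Rightarrow> 'n rpoly set \<Rightarrow> bool" where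
  "annihilates L V \<longleftrightarrow> (\<forall>p\<in>V. L p = 0)"

definition linear_extension :: "('m \<Rightarrow> real) \<Rightarrow> ('m \<Rightarrow>\<^sub>0 real) \<Rightarrow> real" where
  "linear_extension f p = (\<Sum>m\<in>Poly_Mapping.keys p. Poly_Mapping.lookup p m * f m)"

definition tensor_functional ::
    "('n::finite rpoly \<Rightarrow> real) \<Rightarrow> ('n rpoly \<Rightarrow> real) \<Rightarrow> 'n rpoly2 \<Rightarrow> real" where
  "tensor_functional L M = linear_extension (\<lambda>(\<alpha>, \<beta>). L (monomial \<alpha>) * M (monomial \<beta>))"

definition xvar :: "'n::finite \<Rightarrow> 'n rpoly2" where
  "xvar i = monomial2 (Poly_Mapping.single i 1) 0"

definition yvar :: "'n::finite \<Rightarrow> 'n rpoly2" where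
  "yvar i = monomial2 0 (Poly_Mapping.single i 1)"

text \<open>The polynomial \<open>\<parallel>x - y\<parallel>\<^sup>2\<close>; see \<open>eval2_sq_dist_power\<close> below.\<close>

definition sq_dist_poly :: "('n::finite) rpoly2" where
  "sq_dist_poly = (\<Sum>i\<in>UNIV. (xvar i - yvar i)^2)"

definition monomial_value :: "real ^ 'n \<Rightarrow> 'n::finite multi_index \<Rightarrow> real" where
  "monomial_value x \<alpha> = (\<Prod>i\<in>UNIV. (x $ i) ^ Poly_Mapping.lookup \<alpha> i)"

definition eval2 :: "real ^ 'n \<Rightarrow> real ^ 'n \<Rightarrow> 'n::finite rpoly2 \<Rightarrow> real" where
  "eval2 x y = linear_extension (\<lambda>(\<alpha>, \<beta>). monomial_value x \<alpha> * monomial_value y \<beta>)"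


lemma lookup_scaleR [simp]:
  fixes p :: "'m \<Rightarrow>\<^sub>0 real"
  shows "Poly_Mapping.lookup (c *\<^sub>R p) m = c * Poly_Mapping.lookup p m"
proof -
  have "finite {i. c *\<^sub>R Poly_Mapping.lookup p i \<noteq> 0}"
    by (rule finite_subset[OF _ finite_keys[of p]]) (auto simp: in_keys_iff)
  then show ?thesis
    by (simp add: scaleR_poly_mapping_def)
qed

lemma linear_extension_superset:
  assumes "finite A" "Poly_Mapping.keys p \<subseteq> A"
  shows "linear_extension f p = (\<Sum>m\<in>A. Poly_Mapping.lookup p m * f m)"
  unfolding linear_extension_def
  using assms by (intro sum.mono_neutral_left) (auto simp: in_keys_iff)

lemma linear_linear_extension: "linear (linear_extension f)"
proof (rule linearI)
  fix p q :: "'a \<Rightarrow>\<^sub>0 real"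
  let ?A = "Poly_Mapping.keys p \<union> Poly_Mapping.keys q"
  have "linear_extension f (p + q) = (\<Sum>m\<in>?A. Poly_Mapping.lookup (p + q) m * f m)"
    by (rule linear_extension_superset) (auto simp: in_keys_iff lookup_add)
  moreover have "linear_extension f p = (\<Sum>m\<in>?A. Poly_Mapping.lookup p m * f m)"
    by (rule linear_extension_superset) auto
  moreover have "linear_extension f q = (\<Sum>m\<in>?A. Poly_Mapping.lookup q m * f m)"
    by (rule linear_extension_superset) auto
  ultimately show "linear_extension f (p + q) = linear_extension f p + linear_extension f q"
    by (simp add: lookup_add distrib_right sum.distrib)
next
  fix c :: real and p :: "'a \<Rightarrow>\<^sub>0 real"
  have "linear_extension f (c *\<^sub>R p)
      = (\<Sum>m\<in>Poly_Mapping.keys p. Poly_Mapping.lookup (c *\<^sub>R p) m * f m)"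
    by (rule linear_extension_superset) (auto simp: in_keys_iff)
  then show "linear_extension f (c *\<^sub>R p) = c *\<^sub>R linear_extension f p"
    by (simp add: linear_extension_def sum_distrib_left mult.assoc)
qed

lemma linear_extension_single [simp]:
  "linear_extension f (Poly_Mapping.single m c) = c * f m"
  by (cases "c = 0") (simp_all add: linear_extension_def)

lemma poly_expansion:
  fixes p :: "'m \<Rightarrow>\<^sub>0 real"
  shows "p = (\<Sum>m\<in>Poly_Mapping.keys p.
    Poly_Mapping.lookup p m *\<^sub>R Poly_Mapping.single m 1)"
proof (rule poly_mapping_eqI)
  fix k
  have "(\<Sum>m\<in>Poly_Mapping.keys p. Poly_Mapping.lookup p m * (1 when m = k))
      = (\<Sum>m\<in>Poly_Mapping.keys p. if m = k then Poly_Mapping.lookup p m else 0)"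
    by (rule sum.cong) auto
  also have "\<dots> = Poly_Mapping.lookup p k"
    by (simp add: in_keys_iff)
  finally show "Poly_Mapping.lookup p k = Poly_Mapping.lookup (\<Sum>m\<in>Poly_Mapping.keys p.
      Poly_Mapping.lookup p m *\<^sub>R Poly_Mapping.single m 1) k"
    by (simp add: lookup_sum lookup_single)
qed

lemma linear_eq_linear_extension:
  fixes T :: "('m \<Rightarrow>\<^sub>0 real) \<Rightarrow> real"
  assumes "linear T" and "\<And>m. T (Poly_Mapping.single m 1) = f m"
  shows "T = linear_extension f"
proof
  fix p
  have "T p = T (\<Sum>m\<in>Poly_Mapping.keys p. Poly_Mapping.lookup p m *\<^sub>R Poly_Mapping.single m 1)"
    by (subst poly_expansion[of p]) simp
  also have "\<dots> = linear_extension f p"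
    by (simp add: linear_sum[OF assms(1)] linear_cmul[OF assms(1)] assms(2) linear_extension_def)
  finally show "T p = linear_extension f p" .
qed

lemma tensor_functional_unique:
  "linear T \<and> (\<forall>\<alpha> \<beta>. T (monomial2 \<alpha> \<beta>) = L (monomial \<alpha>) * M (monomial \<beta>))
    \<longleftrightarrow> T = tensor_functional L M"
  by (auto simp: tensor_functional_def monomial2_def linear_linear_extension
      intro!: linear_eq_linear_extension)

lemma linear_extension_mult:
  fixes f :: "'m::comm_monoid_add \<Rightarrow> real"
  assumes f: "\<And>m n. f (m + n) = f m * f n"
  shows "linear_extension f (p * q) = linear_extension f p * linear_extension f q"
proof -
  note lin = linear_linear_extension[of f]
  have "p * q = (\<Sum>m\<in>Poly_Mapping.keys p. \<Sum>n\<in>Poly_Mapping.keys q.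
      Poly_Mapping.single m (Poly_Mapping.lookup p m)
        * Poly_Mapping.single n (Poly_Mapping.lookup q n))"
  proof -
    have *: "r = (\<Sum>m\<in>Poly_Mapping.keys r. Poly_Mapping.single m (Poly_Mapping.lookup r m))"
      for r :: "'m \<Rightarrow>\<^sub>0 real"
    proof -
      have "c *\<^sub>R Poly_Mapping.single m 1 = Poly_Mapping.single m c" for m :: 'm and c :: real
        by (rule poly_mapping_eqI) (simp add: lookup_single when_def)
      then show ?thesis
        using poly_expansion[of r] by simp
    qed
    show ?thesis
      by (subst *[of p], subst *[of q]) (simp only: sum_product)
  qed
  then have "linear_extension f (p * q) = (\<Sum>m\<in>Poly_Mapping.keys p. \<Sum>n\<in>Poly_Mapping.keys q.
      Poly_Mapping.lookup p m * Poly_Mapping.lookup q n * (f m * f n))"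
    by (simp add: linear_sum[OF lin] mult_single f)
  also have "\<dots> = linear_extension f p * linear_extension f q"
    by (simp add: linear_extension_def sum_product mult_ac)
  finally show ?thesis .
qed

lemma monomial_value_zero [simp]: "monomial_value x 0 = 1"
  by (simp add: monomial_value_def)

lemma monomial_value_add: "monomial_value x (\<alpha> + \<beta>) = monomial_value x \<alpha> * monomial_value x \<beta>"
  by (simp add: monomial_value_def lookup_add power_add prod.distrib)

lemma monomial_value_single [simp]: "monomial_value x (Poly_Mapping.single i (Suc 0)) = x $ i"
proof -
  have "monomial_value x (Poly_Mapping.single i (Suc 0)) = (\<Prod>j\<in>UNIV. if i = j then x $ j else 1)"
    unfolding monomial_value_def by (rule prod.cong) (auto simp: lookup_single when_def)
  then show ?thesis by simp
qed

lemma eval2_mult: "eval2 x y (p * q) = eval2 x y p * eval2 x y q"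
  unfolding eval2_def by (rule linear_extension_mult) (auto simp: monomial_value_add)

lemma eval2_power: "eval2 x y (p ^ n) = eval2 x y p ^ n"
proof (induction n)
  case 0
  have "eval2 x y (Poly_Mapping.single 0 1) = 1"
    by (simp add: eval2_def zero_prod_def del: single_one)
  then show ?case by simp
qed (simp add: eval2_mult)

lemma eval2_sq_dist_power:
  "eval2 x y (sq_dist_poly ^ r) = norm (x - y) ^ (2 * r)"
proof -
  have lin: "linear (eval2 x y)"
    unfolding eval2_def by (rule linear_linear_extension)
  have "eval2 x y sq_dist_poly = (\<Sum>i\<in>UNIV. (x $ i - y $ i)^2)"
    by (simp add: sq_dist_poly_def linear_sum[OF lin] eval2_power linear_diff[OF lin])
      (simp add: eval2_def xvar_def yvar_def monomial2_def)
  also have "\<dots> = norm (x - y) ^ 2"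
    by (simp add: norm_vec_def L2_set_def sum_nonneg)
  finally show ?thesis
    by (simp add: eval2_power power_mult)
qed

end

(*
  With A = |x|^2, B = |y|^2 and P = x . y we have |x - y|^(2r) = (A + B - 2 P)^r, a combination
  of the products A^a B^b P^c with a + b + c = r, which have bidegree (2a + c, 2b + c).
  If L vanishes in degrees <= k and r <= k, every such term is killed in x or in y.
  Conversely, if L vanishes in degrees < m, only the terms with a = b survive for r = m; their
  coefficients all have the sign (-1)^m, since c = m - 2a, and L \<otimes> L is a sum of squares
  on each of them. Hence (L \<otimes> L)(P^m) = 0, and this is a sum of squares of the values of L
  at all monomials of degree m.
*)

theory Submission
  imports Defs
begin

section \<open>Multi-degree and the building blocks |x|^2, |y|^2 and x . y\<close>

definition evar :: "'n::finite \<Rightarrow> 'n multi_index" where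
  "evar i = Poly_Mapping.single i 1"

definition sq_norm :: "'n::finite rpoly" where
  "sq_norm = (\<Sum>i\<in>UNIV. monomial (evar i + evar i))"

definition sq_norm_x :: "'n::finite rpoly2" where
  "sq_norm_x = (\<Sum>i\<in>UNIV. monomial2 (evar i + evar i) 0)"

definition sq_norm_y :: "'n::finite rpoly2" where
  "sq_norm_y = (\<Sum>i\<in>UNIV. monomial2 0 (evar i + evar i))"

definition dot_xy :: "'n::finite rpoly2" where
  "dot_xy = (\<Sum>i\<in>UNIV. monomial2 (evar i) (evar i))"

lemma multi_degree_zero [simp]: "multi_degree 0 = 0"
  by (simp add: multi_degree_def)

lemma multi_degree_add [simp]: "multi_degree (\<alpha> + \<beta>) = multi_degree \<alpha> + multi_degree \<beta>"
  by (simp add: multi_degree_def lookup_add sum.distrib)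

lemma multi_degree_evar [simp]: "multi_degree (evar i) = 1"
  by (simp add: multi_degree_def evar_def lookup_single when_def)

lemma multi_degree_eq_0_iff: "multi_degree \<alpha> = 0 \<longleftrightarrow> \<alpha> = 0"
  by (auto simp: multi_degree_def intro!: poly_mapping_eqI)

lemma multi_degree_Suc_obtain:
  assumes "multi_degree \<alpha> = Suc n"
  obtains i \<beta> where "\<alpha> = evar i + \<beta>" "multi_degree \<beta> = n"
proof -
  have "\<alpha> \<noteq> 0"
    using assms by auto
  then obtain i where i: "Poly_Mapping.lookup \<alpha> i \<noteq> 0"
    by (metis lookup_zero poly_mapping_eqI)
  \<comment> \<open>Subtraction of exponents is truncated; nothing is lost because the exponent at
    \<open>i\<close> is positive.\<close>
  have eq: "\<alpha> = evar i + (\<alpha> - evar i)"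
    using i by (intro poly_mapping_eqI)
      (auto simp: lookup_add lookup_minus evar_def lookup_single when_def)
  have "multi_degree \<alpha> = 1 + multi_degree (\<alpha> - evar i)"
    by (subst eq) simp
  with eq assms that show thesis
    by simp
qed

lemma monomial_zero [simp]: "monomial 0 = 1"
  by (simp add: monomial_def)

lemma monomial2_zero [simp]: "monomial2 0 0 = 1"
  by (simp add: monomial2_def flip: zero_prod_def)

lemma monomial_mult: "monomial \<alpha> * monomial \<beta> = monomial (\<alpha> + \<beta>)"
  by (simp add: monomial_def mult_single)

lemma monomial2_mult:
  "monomial2 \<alpha> \<beta> * monomial2 \<alpha>' \<beta>' = monomial2 (\<alpha> + \<alpha>') (\<beta> + \<beta>')"
  by (simp add: monomial2_def mult_single)

lemma monomial2_mult_sq_norm_x: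
  "monomial2 \<alpha> \<beta> * sq_norm_x = (\<Sum>i\<in>UNIV. monomial2 (\<alpha> + (evar i + evar i)) \<beta>)"
  by (simp add: sq_norm_x_def sum_distrib_left monomial2_mult)

lemma monomial2_mult_sq_norm_y:
  "monomial2 \<alpha> \<beta> * sq_norm_y = (\<Sum>i\<in>UNIV. monomial2 \<alpha> (\<beta> + (evar i + evar i)))"
  by (simp add: sq_norm_y_def sum_distrib_left monomial2_mult)

lemma monomial2_mult_dot_xy:
  "monomial2 \<alpha> \<beta> * dot_xy = (\<Sum>i\<in>UNIV. monomial2 (\<alpha> + evar i) (\<beta> + evar i))"
  by (simp add: dot_xy_def sum_distrib_left monomial2_mult)

section \<open>Expansion of |x - y|^(2r) in the building blocks\<close>

lemma sq_dist_poly_eq: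
  "(sq_dist_poly :: 'n::finite rpoly2) = (sq_norm_x + sq_norm_y) + of_int (-2) * dot_xy"
proof -
  have "(xvar i - yvar i)^2 = monomial2 (evar i + evar i) 0 + monomial2 0 (evar i + evar i)
      + of_int (-2) * monomial2 (evar i) (evar i)" for i :: 'n
    by (simp add: power2_eq_square algebra_simps xvar_def yvar_def monomial2_mult evar_def)
  then show ?thesis
    by (simp add: sq_dist_poly_def sq_norm_x_def sq_norm_y_def dot_xy_def sum.distrib
        sum_distrib_left sum_negf sum_subtractf)
qed

text \<open>The binomial theorem applied twice: \<open>j\<close> counts the factors taken from the
  two squared norms together, \<open>a\<close> those from \<open>sq_norm_x\<close>, and
  \<open>r - j\<close> those from \<open>dot_xy\<close>.\<close>

lemma sq_dist_poly_power_expansion: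
  "(sq_dist_poly ^ r :: 'n::finite rpoly2) = (\<Sum>j\<le>r. \<Sum>a\<le>j.
     of_int (int (r choose j) * int (j choose a) * (-2) ^ (r - j)) *
       (sq_norm_x ^ a * sq_norm_y ^ (j - a) * dot_xy ^ (r - j)))"
proof -
  have "(of_int (-2) * dot_xy) ^ n = of_int ((-2) ^ n) * (dot_xy ^ n :: 'n rpoly2)" for n
    by (simp only: power_mult_distrib of_int_power)
  then show ?thesis
    unfolding sq_dist_poly_eq binomial_ring
    by (simp only: sum_distrib_left sum_distrib_right of_int_mult of_int_of_nat_eq mult_ac)
qed

text \<open>The factor \<open>of_int n\<close> is an element of the polynomial ring, not a scalar.
  Additivity handles natural multiples, negation the remaining integers.\<close>

lemma linear_of_int_mult:
  fixes T :: "('m::comm_monoid_add \<Rightarrow>\<^sub>0 real) \<Rightarrow> real"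
  assumes "linear T"
  shows "T (of_int n * p) = of_int n * T p"
proof -
  have nat: "T (of_nat k * p) = of_nat k * T p" for k
    by (induction k) (simp_all add: linear_0[OF assms] linear_add[OF assms] distrib_right)
  show ?thesis
    by (cases n rule: int_cases2) (simp_all add: nat linear_neg[OF assms])
qed

section \<open>The functionals \<open>L\<close> and \<open>T\<close> on products of the building
  blocks\<close>

context
  fixes L :: "'n::finite rpoly \<Rightarrow> real"
  assumes L: "linear L"
begin

abbreviation (input) "T \<equiv> tensor_functional L L"

lemma linear_T: "linear T"
  by (simp add: tensor_functional_def linear_linear_extension)

lemma T_monomial2: "T (monomial2 \<alpha> \<beta>) = L (monomial \<alpha>) * L (monomial \<beta>)"
  by (simp add: tensor_functional_def monomial2_def)

lemma annihilates_polys_le_iff: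
  "annihilates L (polys_le k) \<longleftrightarrow> (\<forall>\<alpha>. multi_degree \<alpha> \<le> k \<longrightarrow> L (monomial \<alpha>) = 0)"
proof safe
  fix \<alpha> :: "'n multi_index"
  assume "annihilates L (polys_le k)" "multi_degree \<alpha> \<le> k"
  then show "L (monomial \<alpha>) = 0"
    by (auto simp: annihilates_def polys_le_def monomial_def)
next
  assume *: "\<forall>\<alpha>. multi_degree \<alpha> \<le> k \<longrightarrow> L (monomial \<alpha>) = 0"
  have expand: "L p = linear_extension (\<lambda>\<alpha>. L (monomial \<alpha>)) p" for p
    by (rule fun_cong[OF linear_eq_linear_extension[OF L]]) (simp add: monomial_def)
  have "L p = 0" if "p \<in> polys_le k" for p
    unfolding expand[of p] linear_extension_def
    using that * by (intro sum.neutral) (simp add: polys_le_def)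
  then show "annihilates L (polys_le k)"
    by (simp add: annihilates_def)
qed

lemma L_sq_norm_Suc:
  "L (monomial \<alpha> * sq_norm ^ Suc a)
    = (\<Sum>i\<in>UNIV. L (monomial (\<alpha> + (evar i + evar i)) * sq_norm ^ a))"
proof -
  have "monomial \<alpha> * sq_norm ^ Suc a
      = (\<Sum>i\<in>UNIV. monomial (\<alpha> + (evar i + evar i)) * sq_norm ^ a)"
    by (simp add: mult.assoc[symmetric])
      (simp add: sq_norm_def sum_distrib_left sum_distrib_right monomial_mult)
  then show ?thesis
    by (simp add: linear_sum[OF L])
qed

text \<open>The monomial prefix absorbs one factor \<open>dot_xy\<close>, raising both of its
  degrees by one. This drives the inductions on \<open>c\<close> below, which therefore keep the
  prefix arbitrary.\<close>

lemma T_dot_xy_Suc: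
  "T (monomial2 \<alpha> \<beta> * (p * dot_xy ^ Suc c))
    = (\<Sum>i\<in>UNIV. T (monomial2 (\<alpha> + evar i) (\<beta> + evar i) * (p * dot_xy ^ c)))"
proof -
  have "monomial2 \<alpha> \<beta> * (p * dot_xy ^ Suc c) = (monomial2 \<alpha> \<beta> * dot_xy) * (p * dot_xy ^ c)"
    by (simp add: mult_ac)
  also have "\<dots> = (\<Sum>i\<in>UNIV. monomial2 (\<alpha> + evar i) (\<beta> + evar i) * (p * dot_xy ^ c))"
    by (simp only: monomial2_mult_dot_xy sum_distrib_right)
  finally show ?thesis
    by (simp add: linear_sum[OF linear_T])
qed

text \<open>Without \<open>dot_xy\<close> the polynomial is a product of one in x and one in y, on
  which the tensor product factors.\<close>

lemma T_sq_norms: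
  "T (monomial2 \<alpha> \<beta> * (sq_norm_x ^ a * sq_norm_y ^ b))
    = L (monomial \<alpha> * sq_norm ^ a) * L (monomial \<beta> * sq_norm ^ b)"
proof (induction a arbitrary: \<alpha>)
  case 0
  show ?case
  proof (induction b arbitrary: \<beta>)
    case 0
    show ?case by (simp add: T_monomial2)
  next
    case (Suc b)
    have "monomial2 \<alpha> \<beta> * (sq_norm_x ^ 0 * sq_norm_y ^ Suc b)
        = (monomial2 \<alpha> \<beta> * sq_norm_y) * (sq_norm_x ^ 0 * sq_norm_y ^ b)"
      by (simp add: mult_ac)
    also have "\<dots> = (\<Sum>i\<in>UNIV. monomial2 \<alpha> (\<beta> + (evar i + evar i))
        * (sq_norm_x ^ 0 * sq_norm_y ^ b))"
      by (simp only: monomial2_mult_sq_norm_y sum_distrib_right)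
    finally show ?case
      by (simp only: linear_sum[OF linear_T] Suc L_sq_norm_Suc sum_distrib_left)
  qed
next
  case (Suc a)
  have "monomial2 \<alpha> \<beta> * (sq_norm_x ^ Suc a * sq_norm_y ^ b)
      = (monomial2 \<alpha> \<beta> * sq_norm_x) * (sq_norm_x ^ a * sq_norm_y ^ b)"
    by (simp add: mult_ac)
  also have "\<dots> = (\<Sum>i\<in>UNIV. monomial2 (\<alpha> + (evar i + evar i)) \<beta>
      * (sq_norm_x ^ a * sq_norm_y ^ b))"
    by (simp only: monomial2_mult_sq_norm_x sum_distrib_right)
  finally show ?case
    by (simp only: linear_sum[OF linear_T] Suc L_sq_norm_Suc sum_distrib_right)
qed

text \<open>All monomials of the product have degree
  \<open>multi_degree \<alpha> + 2 * a\<close>.\<close>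

lemma L_sq_norm_eq_0:
  assumes "\<And>\<gamma>. multi_degree \<gamma> < m \<Longrightarrow> L (monomial \<gamma>) = 0"
    and "multi_degree \<alpha> + 2 * a < m"
  shows "L (monomial \<alpha> * sq_norm ^ a) = 0"
  using assms(2)
proof (induction a arbitrary: \<alpha>)
  case 0
  then show ?case by (simp add: assms(1))
next
  case (Suc a)
  then show ?case
    unfolding L_sq_norm_Suc by (intro sum.neutral ballI Suc.IH) simp
qed

text \<open>Peeling off \<open>dot_xy\<close> preserves both total degrees; once none is left, one
  of the two factors in \<open>T_sq_norms\<close> vanishes.\<close>

lemma T_bihomogeneous_eq_0:
  assumes "\<And>\<gamma>. multi_degree \<gamma> < m \<Longrightarrow> L (monomial \<gamma>) = 0"
    and "multi_degree \<alpha> + 2 * a + c < m \<or> multi_degree \<beta> + 2 * b + c < m"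
  shows "T (monomial2 \<alpha> \<beta> * (sq_norm_x ^ a * sq_norm_y ^ b * dot_xy ^ c)) = 0"
  using assms(2)
proof (induction c arbitrary: \<alpha> \<beta>)
  case 0
  then show ?case
    using L_sq_norm_eq_0[OF assms(1)] by (auto simp: T_sq_norms)
next
  case (Suc c)
  then show ?case
    unfolding T_dot_xy_Suc by (intro sum.neutral ballI Suc.IH) auto
qed

text \<open>For \<open>c = 0\<close> the value is a square, and peeling off \<open>dot_xy\<close>
  keeps the two prefixes equal, so the value is a sum of squares.\<close>

lemma T_diagonal_nonneg:
  "T (monomial2 \<alpha> \<alpha> * (sq_norm_x ^ a * sq_norm_y ^ a * dot_xy ^ c)) \<ge> 0"
proof (induction c arbitrary: \<alpha>)
  case 0
  show ?case by (simp add: T_sq_norms)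
next
  case (Suc c)
  then show ?case
    unfolding T_dot_xy_Suc by (intro sum_nonneg)
qed

text \<open>A vanishing sum of nonnegative terms has only zero terms; following the variables of
  \<open>\<gamma>\<close> one at a time leads to the square of
  \<open>L (monomial (\<alpha> + \<gamma>))\<close>.\<close>

lemma T_dot_xy_power_eq_0D:
  assumes "T (monomial2 \<alpha> \<alpha> * dot_xy ^ c) = 0" "multi_degree \<gamma> = c"
  shows "L (monomial (\<alpha> + \<gamma>)) = 0"
  using assms
proof (induction c arbitrary: \<alpha> \<gamma>)
  case 0
  then show ?case by (simp add: T_monomial2 multi_degree_eq_0_iff)
next
  case (Suc c)
  obtain i \<beta> where \<beta>: "\<gamma> = evar i + \<beta>" "multi_degree \<beta> = c"
    using Suc.prems(2) by (rule multi_degree_Suc_obtain)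
  have nonneg: "T (monomial2 \<delta> \<delta> * dot_xy ^ c) \<ge> 0" for \<delta>
    using T_diagonal_nonneg[of \<delta> 0 c] by simp
  have "(\<Sum>j\<in>UNIV. T (monomial2 (\<alpha> + evar j) (\<alpha> + evar j) * dot_xy ^ c)) = 0"
    using Suc.prems(1) T_dot_xy_Suc[of \<alpha> \<alpha> 1 c] by simp
  then have "T (monomial2 (\<alpha> + evar i) (\<alpha> + evar i) * dot_xy ^ c) = 0"
    by (subst (asm) sum_nonneg_eq_0_iff) (auto intro: nonneg)
  from Suc.IH[OF this \<beta>(2)] show ?case
    by (simp add: \<beta>(1) add.assoc)
qed

section \<open>The value of \<open>T\<close> at powers of the squared distance\<close>

lemma T_sq_dist_poly_power:
  "T (sq_dist_poly ^ r) = (\<Sum>j\<le>r. \<Sum>a\<le>j.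
     real (r choose j) * real (j choose a) * (-2) ^ (r - j) *
       T (sq_norm_x ^ a * sq_norm_y ^ (j - a) * dot_xy ^ (r - j)))"
  unfolding sq_dist_poly_power_expansion
  by (simp only: linear_sum[OF linear_T] linear_of_int_mult[OF linear_T]) simp

lemma T_sq_dist_poly_power_eq_0:
  assumes "\<And>\<alpha>. multi_degree \<alpha> \<le> k \<Longrightarrow> L (monomial \<alpha>) = 0" and "r \<le> k"
  shows "T (sq_dist_poly ^ r) = 0"
proof -
  \<comment> \<open>The degrees in x and in y add up to \<open>2 * r\<close>, so one of them is at
    most \<open>r\<close>, hence below \<open>Suc k\<close>.\<close>
  have "T (sq_norm_x ^ a * sq_norm_y ^ (j - a) * dot_xy ^ (r - j)) = 0" if "j \<le> r" "a \<le> j" for j a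
    using T_bihomogeneous_eq_0[of "Suc k" 0 a "r - j" 0 "j - a"] assms that by fastforce
  then show ?thesis
    by (simp add: T_sq_dist_poly_power)
qed

lemma L_monomial_eq_0_if_T_sq_dist_poly_power_eq_0:
  assumes low: "\<And>\<alpha>. multi_degree \<alpha> < m \<Longrightarrow> L (monomial \<alpha>) = 0"
    and T0: "T (sq_dist_poly ^ m) = 0" and "multi_degree \<gamma> = m"
  shows "L (monomial \<gamma>) = 0"
proof -
  \<comment> \<open>The summand of the expansion with the sign of \<open>(-2) ^ (m - j)\<close>
    removed.\<close>
  define t where "t j a = real (m choose j) * real (j choose a) * 2 ^ (m - j) *
    T (sq_norm_x ^ a * sq_norm_y ^ (j - a) * dot_xy ^ (m - j))" for j a
  have off_diagonal: "t j a = 0" if "j \<le> m" "a \<le> j" "j \<noteq> 2 * a" for j a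
  proof -
    \<comment> \<open>The two degrees have sum \<open>2 * m\<close> and differ, so one lies below
      \<open>m\<close>.\<close>
    have "2 * a + (m - j) < m \<or> 2 * (j - a) + (m - j) < m"
      using that by linarith
    then show ?thesis
      using T_bihomogeneous_eq_0[of m 0 a "m - j" 0 "j - a"] low by (simp add: t_def)
  qed
  have nonneg: "t j a \<ge> 0" if "j \<le> m" "a \<le> j" for j a
  proof (cases "j = 2 * a")
    case True
    then show ?thesis
      using T_diagonal_nonneg[of 0 a "m - j"] by (simp add: t_def)
  qed (simp add: off_diagonal that)
  have sign: "real (m choose j) * real (j choose a) * (-2) ^ (m - j) *
      T (sq_norm_x ^ a * sq_norm_y ^ (j - a) * dot_xy ^ (m - j)) = (-1) ^ m * t j a"
    if "j \<le> m" "a \<le> j" for j a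
  proof (cases "j = 2 * a")
    case True
    have "(-2::real) ^ (m - j) = (-1) ^ (m - j) * 2 ^ (m - j)"
      by (simp flip: power_mult_distrib)
    \<comment> \<open>Here \<open>j\<close> is even, so all surviving terms share one sign and
      cannot cancel.\<close>
    moreover have "(-1::real) ^ m = (-1) ^ (m - j)"
      using True \<open>j \<le> m\<close> by (auto simp: minus_one_power_iff)
    ultimately show ?thesis
      by (simp add: t_def)
  next
    case False
    then show ?thesis
      using off_diagonal[OF that False] that by (auto simp: t_def)
  qed
  have "(-1) ^ m * (\<Sum>j\<le>m. \<Sum>a\<le>j. t j a) = T (sq_dist_poly ^ m)"
    unfolding T_sq_dist_poly_power sum_distrib_left
    by (intro sum.cong refl) (simp add: sign)
  then have "(\<Sum>j\<le>m. \<Sum>a\<le>j. t j a) = 0"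
    using T0 by simp
  then have "\<forall>j\<in>{..m}. (\<Sum>a\<le>j. t j a) = 0"
    by (subst (asm) sum_nonneg_eq_0_iff) (auto intro!: sum_nonneg nonneg)
  \<comment> \<open>The index \<open>j = 0\<close> isolates the pure power
    \<open>dot_xy ^ m\<close>, with the nonzero coefficient \<open>2 ^ m\<close>.\<close>
  then have "(\<Sum>a\<le>0. t 0 a) = 0"
    by blast
  then have "T (monomial2 0 0 * dot_xy ^ m) = 0"
    by (simp add: t_def)
  from T_dot_xy_power_eq_0D[OF this assms(3)] show ?thesis
    by simp
qed

end

theorem mainTheorem2:
  fixes L :: "('n::finite) rpoly \<Rightarrow> real" and k :: nat
  assumes "linear L"
  shows "annihilates L (polys_le k) \<longleftrightarrow>
    (\<forall>r::nat. 0 \<le> r \<and> r \<le> k \<longrightarrow> tensor_functional L L (sq_dist_poly ^ r) = 0)"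
proof
  assume "annihilates L (polys_le k)"
  then show "\<forall>r::nat. 0 \<le> r \<and> r \<le> k \<longrightarrow> tensor_functional L L (sq_dist_poly ^ r) = 0"
    using T_sq_dist_poly_power_eq_0[OF assms, of k] by (simp add: annihilates_polys_le_iff[OF assms])
next
  assume *: "\<forall>r::nat. 0 \<le> r \<and> r \<le> k \<longrightarrow> tensor_functional L L (sq_dist_poly ^ r) = 0"
  have "L (monomial \<alpha>) = 0" if "multi_degree \<alpha> \<le> k" for \<alpha>
    using that
  proof (induction "multi_degree \<alpha>" arbitrary: \<alpha> rule: less_induct)
    \<comment> \<open>Induction on the degree: the power \<open>r = multi_degree \<alpha>\<close>
      settles exactly that degree once all lower ones are known to vanish.\<close>
    case less
    have "tensor_functional L L (sq_dist_poly ^ multi_degree \<alpha>) = 0"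
      using * less.prems by blast
    moreover have "L (monomial \<beta>) = 0" if "multi_degree \<beta> < multi_degree \<alpha>" for \<beta>
      using less.hyps[OF that] that less.prems by linarith
    ultimately show ?case
      using L_monomial_eq_0_if_T_sq_dist_poly_power_eq_0[OF assms _ _ refl] by blast
  qed
  then show "annihilates L (polys_le k)"
    by (simp add: annihilates_polys_le_iff[OF assms])
qed

end
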